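(* Let $\mathcal X=\mathbb R^d$ and suppose that assumptions (L), (B), (V), (TV), (M) of the context hold. Let the step sizes $\gamma_t>0$ satisfy $\sup_{t\ge1}\gamma_t\le\frac{1}{2L(1+\sigma_1^2)}$. Then for any $T\ge1$, the iterates $\{\theta_t\}_{t\ge0}$ generated by the clipped SGD algorithm of the context (clipping threshold $c>0$) satisfy $$\sum_{t=0}^{T-1}\gamma_{t+1}\,\mathbb E\big[\|\nabla f(\theta_t;\theta_t)\|^2\big]\le 8\Delta_0+4L\sigma_0^2\sum_{t=0}^{T-1}\gamma_{t+1}^2+8\,\mathsf b(\beta,c)\sum_{t=0}^{T-1}\gamma_{t+1},$$ where $\Delta_0:=\mathbb E[f(\theta_0;\theta_0)-\ell^\star]$ and $$\mathsf b(\beta,c)=\ell_{\max}\beta\big(\sigma_0+8(1+\sigma_1^2)\ell_{\max}\beta\big)+2\max\{G-c,0\}^2.$$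
   Context: Setting. $\mathcal X=\mathbb R^d$, $\mathsf Z$ is the sample space (a subset of a Euclidean space), $\ell(\theta;z)$ is a (possibly non-convex) loss function differentiable in $\theta$, and for each $\theta\in\mathbb R^d$, $\mathcal D(\theta)$ is a probability distribution on $\mathsf Z$. $\nabla\ell(\theta;z)$ is the gradient in $\theta$. Write $f(\theta_1;\theta_2):=\mathbb E_{Z\sim\mathcal D(\theta_2)}[\ell(\theta_1;Z)]$; $\nabla f(\theta_1;\theta_2)$ is the gradient with respect to the first argument. $\|\cdot\|$ is the Euclidean norm. Assumptions: (L) $\|\nabla\ell(\theta_1;z_1)-\nabla\ell(\theta_2;z_2)\|\le L(\|\theta_1-\theta_2\|+\|z_1-z_2\|)$ for all $\theta_1,\theta_2$, $z_1,z_2\in\mathsf Z$; and there is a constant $\ell^\star>-\infty$ with $\ell(\theta;z)\ge\ell^\star$ for all $\theta$ (and all $z$). (B) $\sup_{\theta,z}\|\nabla\ell(\theta;z)\|\le G$. (V) There are $\sigma_0,\sigma_1\ge0$ such that $\mathbb E_{Z\sim\mathcal D(\theta_2)}[\|\nabla\ell(\theta_1;Z)-\nabla f(\theta_1;\theta_2)\|^2]\le\sigma_0^2+\sigma_1^2\|\nabla f(\theta_1;\theta_2)\|^2$ for all $\theta_1,\theta_2$. (TV) There is $\beta\ge0$ with $d_{TV}(\mathcal D(\theta),\mathcal D(\theta'))\le\beta\|\theta-\theta'\|$ for all $\theta,\theta'$, where $d_{TV}$ is the total variation distance. (M) There is $\ell_{\max}\ge0$ with $\sup_{\theta,z}|\ell(\theta;z)|\le\ell_{\max}$.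 Clipping: $\mathrm{clip}_c(g):=\min\{1,c/\|g\|\}\,g$ for $g\in\mathbb R^d$. Clipped SGD (with greedy deployment): from $\theta_0$, for $t\ge0$, given the past draw $Z_{t+1}\sim\mathcal D(\theta_t)$ and set $\theta_{t+1}=\theta_t-\gamma_{t+1}\,\mathrm{clip}_c(\nabla\ell(\theta_t;Z_{t+1}))$. *)

theory Defs
  imports "HOL-Probability.Probability"
begin

definition grad :: "('a::real_inner \<Rightarrow> real) \<Rightarrow> 'a \<Rightarrow> 'a" where
  "grad f x = (THE g. GDERIV f x :> g)"

text \<open>For probability measures the supremum ranges over a nonempty set of reals bounded by 1.\<close>

definition tv_dist :: "'z measure \<Rightarrow> 'z measure \<Rightarrow> real" where
  "tv_dist P Q = (SUP A\<in>sets P. \<bar>measure P A - measure Q A\<bar>)"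

definition risk :: "('a \<Rightarrow> 'z measure) \<Rightarrow> ('a \<Rightarrow> 'z \<Rightarrow> real) \<Rightarrow> 'a \<Rightarrow> 'a \<Rightarrow> real" where
  "risk D loss \<theta>1 \<theta>2 = (\<integral>z. loss \<theta>1 z \<partial>D \<theta>2)"

definition grad_loss :: "('a::real_inner \<Rightarrow> 'z \<Rightarrow> real) \<Rightarrow> 'a \<Rightarrow> 'z \<Rightarrow> 'a" where
  "grad_loss loss \<theta> z = grad (\<lambda>x. loss x z) \<theta>"

definition grad_risk ::
  "('a::real_inner \<Rightarrow> 'z measure) \<Rightarrow> ('a \<Rightarrow> 'z \<Rightarrow> real) \<Rightarrow> 'a \<Rightarrow> 'a \<Rightarrow> 'a" where
  "grad_risk D loss \<theta>1 \<theta>2 = grad (\<lambda>x. risk D loss x \<theta>2) \<theta>1"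

text \<open>At \<open>g = 0\<close> the convention \<open>c / 0 = 0\<close> is harmless, since the result is \<open>0\<close> anyway.\<close>

definition clip :: "real \<Rightarrow> 'a::real_normed_vector \<Rightarrow> 'a" where
  "clip c g = min 1 (c / norm g) *\<^sub>R g"

text \<open>The \<open>\<sigma>\<close>-algebra on \<open>space M\<close> generated by the initial point and the first \<open>t\<close> draws
  \<open>Z 1, \<dots>, Z t\<close>.\<close>

definition past ::
  "'w measure \<Rightarrow> ('w \<Rightarrow> 'a::topological_space) \<Rightarrow> (nat \<Rightarrow> 'w \<Rightarrow> 'z::topological_space) \<Rightarrow> nat \<Rightarrow> 'w measure"
  where
  "past M \<theta>0 Z t = sigma (space M)
     ({\<theta>0 -` A \<inter> space M | A. A \<in> sets borel} \<union>
      {Z s -` A \<inter> space M | s A. s \<in> {1..t} \<and> A \<in> sets borel})"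

text \<open>\<open>S\<close> is the sample space. The fourth conjunct says that \<open>D (\<theta> t)\<close> is the conditional
  distribution of \<open>Z (t + 1)\<close> given the past; the iterates are driven by these same draws.
  The initial point may be random.\<close>

definition clipped_SGD ::
  "'w measure \<Rightarrow> 'z::topological_space set \<Rightarrow> ('a::euclidean_space \<Rightarrow> 'z measure) \<Rightarrow>
   ('a \<Rightarrow> 'z \<Rightarrow> real) \<Rightarrow> (nat \<Rightarrow> real) \<Rightarrow> real \<Rightarrow>
   (nat \<Rightarrow> 'w \<Rightarrow> 'a) \<Rightarrow> (nat \<Rightarrow> 'w \<Rightarrow> 'z) \<Rightarrow> bool" where
  "clipped_SGD M S D loss \<gamma> c \<theta> Z \<longleftrightarrow>
     prob_space M \<and>
     \<theta> 0 \<in> borel_measurable M \<and>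
     (\<forall>t. Z (Suc t) \<in> measurable M (restrict_space borel S)) \<and>
     (\<forall>t. \<forall>A \<in> sets (restrict_space borel S).
        AE \<omega> in M. real_cond_exp M (past M (\<theta> 0) Z t)
          (indicator (Z (Suc t) -` A \<inter> space M)) \<omega> = measure (D (\<theta> t \<omega>)) A) \<and>
     (\<forall>t. \<forall>\<omega> \<in> space M.
        \<theta> (Suc t) \<omega> = \<theta> t \<omega> - \<gamma> (Suc t) *\<^sub>R clip c (grad_loss loss (\<theta> t \<omega>) (Z (Suc t) \<omega>)))"

definition clip_bias :: "real \<Rightarrow> real \<Rightarrow> real \<Rightarrow> real \<Rightarrow> real \<Rightarrow> real \<Rightarrow> real" where
  "clip_bias lmax \<sigma>0 \<sigma>1 G \<beta> c =
     lmax * \<beta> * (\<sigma>0 + 8 * (1 + \<sigma>1\<^sup>2) * lmax * \<beta>) + 2 * (max (G - c) 0)\<^sup>2"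

end

theory Submission
  imports Defs
begin

text \<open>Let \<open>R x = risk D loss x x\<close> be the risk of the parameter \<open>x\<close> under the distribution that \<open>x\<close> itself
  induces. The proof is a descent argument for \<open>R\<close>, although \<open>R\<close> need not be differentiable: a step
  from \<open>x\<close> to \<open>y\<close> is split into \<open>risk y x - risk x x\<close>, where the distribution stays \<open>D x\<close> and smoothness of
  the loss gives the usual descent inequality (\<open>risk_quadratic_approximation\<close>), and
  \<open>risk y y - risk y x\<close>, where only the distribution changes and which is at most
  \<open>2 lmax \<beta> \<parallel>y - x\<parallel>\<close> (\<open>risk_shift\<close>). Averaging over a draw from \<open>D x\<close>, the clipping bias, the noise and
  the shift are absorbed by Young's inequality, and a quarter of the squared gradient is left
  (\<open>clipped_step_decrease\<close>).

  Along the iterates, \<open>D (\<theta> t)\<close> is the conditional law of the next draw given the past, so the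
  expectation of \<open>R (\<theta> (t + 1))\<close> is that of the average treated for fixed \<open>x\<close>, taken at \<open>x = \<theta> t\<close>
  (\<open>expectation_given_past\<close>). Summation telescopes, and \<open>R\<close> is bounded below by \<open>lstar\<close>.

  The constants need care. Total variation is a supremum over events, so the shift term carries
  \<open>2 lmax\<close>, and its noise part is \<open>2 lmax \<beta> \<sigma>0\<close> per unit of step size. Retaining only an eighth of
  the squared gradient would turn it into \<open>16 lmax \<beta> \<sigma>0\<close>, twice what \<open>8 * clip_bias\<close> provides. Retaining
  a quarter means multiplying by \<open>4\<close> only, which gives exactly \<open>8 lmax \<beta> \<sigma>0\<close>, and the other terms have
  enough slack for it.\<close>

section \<open>Gradients and the quadratic bound\<close>

lemma GDERIV_unique:
  fixes f :: "'a::real_inner \<Rightarrow> real"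
  assumes "GDERIV f x :> g" "GDERIV f x :> h"
  shows "g = h"
proof -
  have "(\<lambda>k. k \<bullet> g) = (\<lambda>k. k \<bullet> h)"
    using assms unfolding gderiv_def by (rule has_derivative_unique)
  then show ?thesis
    by (metis vector_eq_ldot)
qed

lemma grad_eqI: "GDERIV f x :> g \<Longrightarrow> grad f x = g"
  unfolding grad_def by (blast intro: GDERIV_unique)

lemma GDERIV_grad:
  fixes f :: "'a::euclidean_space \<Rightarrow> real"
  assumes "f differentiable (at x)"
  shows "GDERIV f x :> grad f x"
proof -
  obtain f' where f': "(f has_derivative f') (at x)"
    using assms unfolding differentiable_def by blast
  then have "f' = (\<lambda>h. h \<bullet> adjoint f' 1)"
    by (auto simp: adjoint_works has_derivative_linear)
  then have "GDERIV f x :> adjoint f' 1"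
    using f' by (metis gderiv_def)
  then show ?thesis
    using grad_eqI by metis
qed

text \<open>Along the segment from \<open>x\<close> to \<open>y\<close>, subtracting from \<open>f\<close> its linearisation at \<open>x\<close> and the
  quadratic term leaves a function of one real variable whose derivative is nonpositive, because the
  gradient moves by at most \<open>L s \<parallel>y - x\<parallel>\<close> up to parameter \<open>s\<close>.\<close>

lemma quadratic_upper_bound:
  fixes f :: "'a::real_inner \<Rightarrow> real"
  assumes deriv: "\<And>x. GDERIV f x :> F x"
    and lip: "\<And>x y. norm (F x - F y) \<le> L * norm (x - y)"
  shows "f y \<le> f x + F x \<bullet> (y - x) + L / 2 * (norm (y - x))\<^sup>2"
proof -
  define d where "d = y - x"
  define \<psi> where "\<psi> = (\<lambda>s. f (x + s *\<^sub>R d) - s * (F x \<bullet> d) - L / 2 * s\<^sup>2 * (norm d)\<^sup>2)"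
  have \<psi>': "(\<psi> has_real_derivative (F (x + s *\<^sub>R d) - F x) \<bullet> d - L * s * (norm d)\<^sup>2) (at s)" for s
  proof -
    have "((\<lambda>s. f (x + s *\<^sub>R d)) has_derivative (\<lambda>h. (h *\<^sub>R d) \<bullet> F (x + s *\<^sub>R d))) (at s)"
      by (rule has_derivative_compose[of "\<lambda>s. x + s *\<^sub>R d"])
         (use deriv in \<open>auto simp: gderiv_def intro!: derivative_eq_intros\<close>)
    then have "((\<lambda>s. f (x + s *\<^sub>R d)) has_real_derivative F (x + s *\<^sub>R d) \<bullet> d) (at s)"
      by (rule has_derivative_imp_has_field_derivative) (simp add: inner_commute)
    then show ?thesis
      unfolding \<psi>_def by (auto intro!: derivative_eq_intros simp: inner_diff_left)
  qed
  have "\<psi> 1 \<le> \<psi> 0"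
  proof (rule DERIV_nonpos_imp_nonincreasing[of 0 1])
    fix s :: real assume s: "0 \<le> s" "s \<le> 1"
    have "(F (x + s *\<^sub>R d) - F x) \<bullet> d \<le> norm (F (x + s *\<^sub>R d) - F x) * norm d"
      by (rule norm_cauchy_schwarz)
    also have "\<dots> \<le> (L * norm (s *\<^sub>R d)) * norm d"
      using lip[of "x + s *\<^sub>R d" x] by (intro mult_right_mono) auto
    also have "\<dots> = L * s * (norm d)\<^sup>2"
      using s by (simp add: power2_eq_square)
    finally show "\<exists>y. (\<psi> has_real_derivative y) (at s) \<and> y \<le> 0"
      using \<psi>' by (intro exI[of _ "(F (x + s *\<^sub>R d) - F x) \<bullet> d - L * s * (norm d)\<^sup>2"] conjI) auto
  qed simp
  then show ?thesis
    by (simp add: \<psi>_def d_def)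
qed

lemma quadratic_approximation:
  fixes f :: "'a::real_inner \<Rightarrow> real"
  assumes deriv: "\<And>x. GDERIV f x :> F x"
    and lip: "\<And>x y. norm (F x - F y) \<le> L * norm (x - y)"
  shows "\<bar>f y - f x - F x \<bullet> (y - x)\<bar> \<le> L / 2 * (norm (y - x))\<^sup>2"
proof -
  have "- f y \<le> - f x + (- F x) \<bullet> (y - x) + L / 2 * (norm (y - x))\<^sup>2"
  proof (rule quadratic_upper_bound)
    show "norm (- F u - - F v) \<le> L * norm (u - v)" for u v
      using lip[of v u] by (simp add: norm_minus_commute)
  qed (rule GDERIV_minus[OF deriv])
  with quadratic_upper_bound[OF assms, of y x] show ?thesis
    unfolding inner_minus_left by linarith
qed

text \<open>Together with the previous lemma, this lets one differentiate under an expectation without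
  dominated convergence: a bound on the remainder of each sample loss that is uniform in the sample
  survives integration, and it already determines the gradient of the integrated function.\<close>

lemma GDERIV_of_quadratic_approximation:
  fixes f :: "'a::real_inner \<Rightarrow> real"
  assumes "\<And>y. \<bar>f y - f x - g \<bullet> (y - x)\<bar> \<le> C * (norm (y - x))\<^sup>2"
  shows "GDERIV f x :> g"
  unfolding gderiv_def has_derivative_at
proof
  have lim: "((\<lambda>h. C * norm h) \<longlongrightarrow> 0) (at 0)"
    by (auto intro!: tendsto_eq_intros)
  show "(\<lambda>h. norm (f (x + h) - f x - h \<bullet> g) / norm h) \<midarrow>0\<rightarrow> 0"
  proof (rule Lim_null_comparison[OF _ lim])
    have "norm (f (x + h) - f x - h \<bullet> g) / norm h \<le> C * norm h" if "h \<noteq> 0" for h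
      using assms[of "x + h"] that by (simp add: divide_simps power2_eq_square inner_commute mult.assoc)
    then show "\<forall>\<^sub>F h in at 0. norm (norm (f (x + h) - f x - h \<bullet> g) / norm h) \<le> C * norm h"
      by (auto simp: eventually_at_filter)
  qed
qed (rule bounded_linear_inner_left)

section \<open>Clipping\<close>

lemma norm_clip_le: "0 \<le> c \<Longrightarrow> norm (clip c g) \<le> norm g"
  by (auto simp: clip_def min_def divide_simps mult_left_le_one_le)

lemma norm_diff_clip:
  assumes "0 \<le> c"
  shows "norm (g - clip c g) = max (norm g - c) 0"
proof (cases "norm g \<le> c")
  case True
  then show ?thesis
    by (cases "g = 0") (auto simp: clip_def)
next
  case False
  then have g: "norm g > c" "norm g > 0"
    using assms by auto
  then have "clip c g = (c / norm g) *\<^sub>R g"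
    by (simp add: clip_def min_def)
  then have "g - clip c g = (1 - c / norm g) *\<^sub>R g"
    by (simp add: scaleR_diff_left)
  then show ?thesis
    using g by (simp add: abs_of_nonneg left_diff_distrib)
qed

lemma borel_measurable_clip [measurable]:
  "(clip c :: 'a::{second_countable_topology, real_normed_vector} \<Rightarrow> 'a) \<in> borel_measurable borel"
  unfolding clip_def by measurable

section \<open>Total variation distance\<close>

lemma measure_le_tv_dist:
  assumes "prob_space P" "prob_space Q" "A \<in> sets P"
  shows "\<bar>measure P A - measure Q A\<bar> \<le> tv_dist P Q"
  unfolding tv_dist_def
proof (rule cSUP_upper)
  show "bdd_above ((\<lambda>A. \<bar>measure P A - measure Q A\<bar>) ` sets P)"
  proof (rule bdd_aboveI2)
    fix B
    show "\<bar>measure P B - measure Q B\<bar> \<le> 1"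
      using prob_space.prob_le_1[OF assms(1), of B] prob_space.prob_le_1[OF assms(2), of B]
        measure_nonneg[of P B] measure_nonneg[of Q B] by linarith
  qed
qed (rule assms)

lemma tv_dist_nonneg:
  assumes "prob_space P" "prob_space Q"
  shows "0 \<le> tv_dist P Q"
  using measure_le_tv_dist[OF assms sets.empty_sets] by simp

text \<open>The layer-cake formula writes \<open>\<integral>h + C\<close> as the integral over the levels \<open>s \<in> {-C..C}\<close> of the
  probability of \<open>{h > s}\<close>. At each level the two probabilities differ by at most the distance, and the
  levels fill an interval of length \<open>2 C\<close>. The factor \<open>2\<close> is sharp for the distance defined as a supremum
  over events: two point masses and \<open>h = \<plusminus>C\<close> attain it.\<close>

lemma integral_diff_le_tv_dist:
  fixes h :: "'a \<Rightarrow> real"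
  assumes P: "prob_space P" and Q: "prob_space Q" and sets: "sets Q = sets P"
    and h[measurable]: "h \<in> borel_measurable P" and bound: "\<And>z. z \<in> space P \<Longrightarrow> \<bar>h z\<bar> \<le> C"
  shows "(\<integral>z. h z \<partial>P) - (\<integral>z. h z \<partial>Q) \<le> 2 * C * tv_dist P Q"
proof -
  interpret P: prob_space P by fact
  interpret Q: prob_space Q by fact
  have space: "space Q = space P"
    using sets by (rule sets_eq_imp_space_eq)
  have hQ[measurable]: "h \<in> borel_measurable Q"
    using h by (simp cong: measurable_cong_sets add: sets)
  have C: "0 \<le> C"
    using bound P.not_empty by force
  have Q_nonneg: "0 \<le> (\<integral>z. h z \<partial>Q) + C"
  proof -
    have "\<bar>\<integral>z. h z \<partial>Q\<bar> \<le> (\<integral>z. \<bar>h z\<bar> \<partial>Q)"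
      by (rule integral_abs_bound)
    also have "\<dots> \<le> (\<integral>z. C \<partial>Q)"
      using bound C space by (intro integral_mono') auto
    finally show ?thesis
      by (simp add: Q.prob_space abs_le_iff)
  qed
  have layer: "ennreal ((\<integral>z. h z \<partial>N) + C)
      = (\<integral>\<^sup>+s\<in>{-C..C}. ennreal (measure N {z \<in> space N. s < h z}) \<partial>lborel)"
    if N: "prob_space N" "h \<in> borel_measurable N" "space N = space P" for N
  proof -
    interpret N: prob_space N by fact
    have [measurable]: "h \<in> borel_measurable N" by fact
    have int: "integrable N h"
      using bound N by (intro N.integrable_const_bound[where B = C]) auto
    have "ennreal ((\<integral>z. h z \<partial>N) + C) = ennreal (\<integral>z. h z + C \<partial>N)"
      using int by (simp add: N.prob_space)
    also have "\<dots> = (\<integral>\<^sup>+z. ennreal (h z + C) \<partial>N)"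
      using int bound N by (intro nn_integral_eq_integral[symmetric]) (fastforce simp: abs_le_iff intro: AE_I2)+
    also have "\<dots> = (\<integral>\<^sup>+z. \<integral>\<^sup>+s. indicator {-C..<h z} s \<partial>lborel \<partial>N)"
    proof (rule nn_integral_cong)
      fix z assume "z \<in> space N"
      then have "- C \<le> h z"
        using bound[of z] N by auto
      then show "ennreal (h z + C) = (\<integral>\<^sup>+s. indicator {-C..<h z} s \<partial>lborel)"
        by simp
    qed
    \<comment> \<open>The level set is split into a factor in \<open>s\<close> and the event \<open>{h > s}\<close>, ready for exchanging the integrals.\<close>
    also have "\<dots> = (\<integral>\<^sup>+z. \<integral>\<^sup>+s. indicator {-C..C} s * indicator {z. s < h z} z \<partial>lborel \<partial>N)"
      using bound N by (intro nn_integral_cong) (fastforce simp: indicator_def abs_le_iff)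
    also have "\<dots> = (\<integral>\<^sup>+s. \<integral>\<^sup>+z. indicator {-C..C} s * indicator {z. s < h z} z \<partial>N \<partial>lborel)"
    proof -
      interpret pair_sigma_finite N lborel ..
      show ?thesis
        by (subst Fubini') (auto simp: indicator_def)
    qed
    also have "\<dots> = (\<integral>\<^sup>+s\<in>{-C..C}. ennreal (measure N {z \<in> space N. s < h z}) \<partial>lborel)"
    proof (rule nn_integral_cong)
      fix s
      have "(\<integral>\<^sup>+z. indicator {-C..C} s * indicator {z. s < h z} z \<partial>N)
          = (\<integral>\<^sup>+z. indicator {-C..C} s * indicator {z \<in> space N. s < h z} z \<partial>N)"
        by (intro nn_integral_cong) (auto simp: indicator_def)
      also have "\<dots> = indicator {-C..C} s * emeasure N {z \<in> space N. s < h z}"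
        by (subst nn_integral_cmult) auto
      finally show "(\<integral>\<^sup>+z. indicator {-C..C} s * indicator {z. s < h z} z \<partial>N)
          = ennreal (measure N {z \<in> space N. s < h z}) * indicator {-C..C} s"
        by (simp add: N.emeasure_eq_measure mult.commute)
    qed
    finally show ?thesis .
  qed
  have meas[measurable]: "(\<lambda>s. measure Q {z \<in> space Q. s < h z}) \<in> borel_measurable borel"
    by measurable
  have "ennreal ((\<integral>z. h z \<partial>P) + C)
      = (\<integral>\<^sup>+s\<in>{-C..C}. ennreal (measure P {z \<in> space P. s < h z}) \<partial>lborel)"
    by (rule layer[OF P h refl])
  also have "\<dots> \<le> (\<integral>\<^sup>+s. ennreal (measure Q {z \<in> space Q. s < h z}) * indicator {-C..C} s
      + ennreal (tv_dist P Q) * indicator {-C..C} s \<partial>lborel)"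
  proof (rule nn_integral_mono)
    fix s :: real
    have "measure P {z \<in> space P. s < h z} \<le> measure Q {z \<in> space Q. s < h z} + tv_dist P Q"
      using measure_le_tv_dist[OF P Q, of "{z \<in> space P. s < h z}"] by (simp add: space)
    then show "ennreal (measure P {z \<in> space P. s < h z}) * indicator {-C..C} s
        \<le> ennreal (measure Q {z \<in> space Q. s < h z}) * indicator {-C..C} s
          + ennreal (tv_dist P Q) * indicator {-C..C} s"
      using tv_dist_nonneg[OF P Q]
      by (auto simp: indicator_def ennreal_plus[symmetric] simp del: ennreal_plus intro!: ennreal_leI)
  qed
  also have "\<dots> = (\<integral>\<^sup>+s\<in>{-C..C}. ennreal (measure Q {z \<in> space Q. s < h z}) \<partial>lborel)
      + (\<integral>\<^sup>+s\<in>{-C..C}. ennreal (tv_dist P Q) \<partial>lborel)"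
    by (rule nn_integral_add) auto
  also have "\<dots> = ennreal ((\<integral>z. h z \<partial>Q) + C) + ennreal (tv_dist P Q) * ennreal (2 * C)"
    using C layer[OF Q hQ space] by (simp add: nn_integral_cmult_indicator)
  also have "\<dots> = ennreal ((\<integral>z. h z \<partial>Q) + C + 2 * C * tv_dist P Q)"
    using C Q_nonneg tv_dist_nonneg[OF P Q]
    by (simp add: ennreal_mult[symmetric] ennreal_plus[symmetric] mult_ac del: ennreal_plus)
  finally have "(\<integral>z. h z \<partial>P) + C \<le> (\<integral>z. h z \<partial>Q) + C + 2 * C * tv_dist P Q"
    by (rule ennreal_le_iff[THEN iffD1, rotated]) (use C Q_nonneg tv_dist_nonneg[OF P Q] in simp)
  then show ?thesis
    by simp
qed

section \<open>Conditional laws given the past\<close>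

text \<open>If \<open>K (X \<omega>)\<close> is the conditional distribution of \<open>Y\<close> given a \<open>\<sigma>\<close>-algebra \<open>F\<close> for which \<open>X\<close> is
  measurable, then the pair \<open>(X, Y)\<close> can be sampled by drawing \<open>X\<close> and then \<open>Y\<close> from \<open>K X\<close>. The
  conditional probabilities settle this on rectangles \<open>A \<times> B\<close>, because the indicator of \<open>X \<in> A\<close> can be
  pulled out of the conditional expectation, and rectangles generate the product \<open>\<sigma>\<close>-algebra.\<close>

lemma (in prob_space) joint_distr_eq_bind:
  assumes F: "subalgebra M F"
    and X: "X \<in> measurable F N" and Y: "Y \<in> measurable M R"
    and K: "K \<in> measurable N (subprob_algebra R)"
    and cond: "\<And>B. B \<in> sets R \<Longrightarrow>
      AE \<omega> in M. real_cond_exp M F (indicator (Y -` B \<inter> space M)) \<omega> = measure (K (X \<omega>)) B"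
  shows "distr M (N \<Otimes>\<^sub>M R) (\<lambda>\<omega>. (X \<omega>, Y \<omega>))
    = M \<bind> (\<lambda>\<omega>. distr (K (X \<omega>)) (N \<Otimes>\<^sub>M R) (Pair (X \<omega>)))" (is "?J = ?B")
proof -
  interpret F: finite_measure_subalgebra M F
    by unfold_locales (rule F)
  have [measurable]: "X \<in> measurable M N"
    using measurable_from_subalg[OF F X] .
  note X[measurable] Y[measurable] K[measurable]
  have kernel[measurable]: "(\<lambda>\<omega>. distr (K (X \<omega>)) (N \<Otimes>\<^sub>M R) (Pair (X \<omega>)))
      \<in> measurable M (subprob_algebra (N \<Otimes>\<^sub>M R))"
    by (rule measurable_distr2[where M = R]) measurable
  have sets_K: "sets (K x) = sets R" "finite_measure (K x)" if "x \<in> space N" for x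
    using measurable_space[OF K that]
    by (auto simp: space_subprob_algebra subprob_space.axioms)
  let ?E = "{A \<times> B | A B. A \<in> sets N \<and> B \<in> sets R}"
  show ?thesis
  proof (rule measure_eqI_generator_eq[OF Int_stable_pair_measure_generator[of N R]])
    show "?E \<subseteq> Pow (space N \<times> space R)"
      using sets.space_closed[of N] sets.space_closed[of R] by auto
    show "sets ?J = sigma_sets (space N \<times> space R) ?E"
      by (simp add: sets_pair_measure)
    show "sets ?B = sigma_sets (space N \<times> space R) ?E"
      by (subst sets_bind[where N = "N \<Otimes>\<^sub>M R"]) (auto simp: sets_pair_measure not_empty)
    show "range (\<lambda>_::nat. space N \<times> space R) \<subseteq> ?E" "(\<Union>i::nat. space N \<times> space R) = space N \<times> space R"
      by auto
    show "emeasure ?J (space N \<times> space R) \<noteq> \<infinity>"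
      by (simp add: emeasure_distr)
    fix U assume "U \<in> ?E"
    then obtain A B where U: "U = A \<times> B" and A[measurable]: "A \<in> sets N" and B[measurable]: "B \<in> sets R"
      by auto
    let ?a = "indicator (X -` A \<inter> space M) :: _ \<Rightarrow> real"
    let ?b = "indicator (Y -` B \<inter> space M) :: _ \<Rightarrow> real"
    have sF: "space F = space M"
      using F by (simp add: subalgebra_def)
    have a[measurable]: "?a \<in> borel_measurable F"
      using measurable_sets[OF X A] by (simp add: sF)
    have [measurable]: "?a \<in> borel_measurable M"
      by measurable
    have b[measurable]: "?b \<in> borel_measurable M"
      by measurable
    have ab: "integrable M (\<lambda>\<omega>. ?a \<omega> * ?b \<omega>)"
      by (intro integrable_const_bound[where B = 1]) (auto simp: indicator_def)
    have [measurable]: "(\<lambda>\<omega>. measure (K (X \<omega>)) B) \<in> borel_measurable M"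
      by measurable
    have le1: "measure (K x) B \<le> 1" if "x \<in> space N" for x
      using measurable_space[OF K that] subprob_space.subprob_measure_le_1[of "K x" B]
      by (auto simp: space_subprob_algebra)
    have "emeasure ?J U = emeasure M ((\<lambda>\<omega>. (X \<omega>, Y \<omega>)) -` (A \<times> B) \<inter> space M)"
      by (simp add: U emeasure_distr)
    also have "\<dots> = ennreal (measure M ((X -` A \<inter> space M) \<inter> (Y -` B \<inter> space M)))"
      unfolding emeasure_eq_measure by (intro arg_cong[where f = "\<lambda>A. ennreal (measure M A)"]) auto
    also have "\<dots> = ennreal (\<integral>\<omega>. ?a \<omega> * ?b \<omega> \<partial>M)"
      by (simp add: indicator_inter_arith[symmetric] Int_ac)
    also have "\<dots> = ennreal (\<integral>\<omega>. ?a \<omega> * real_cond_exp M F ?b \<omega> \<partial>M)"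
      using F.real_cond_exp_intg(2)[OF ab a b] by simp
    also have "\<dots> = ennreal (\<integral>\<omega>. ?a \<omega> * measure (K (X \<omega>)) B \<partial>M)"
      using cond[OF B] by (intro arg_cong[where f = ennreal] integral_cong_AE) auto
    also have "\<dots> = (\<integral>\<^sup>+\<omega>. ennreal (?a \<omega> * measure (K (X \<omega>)) B) \<partial>M)"
      using measurable_space[OF \<open>X \<in> measurable M N\<close>] le1
      by (intro nn_integral_eq_integral[symmetric] integrable_const_bound[where B = 1])
         (auto simp: indicator_def)
    also have "\<dots> = (\<integral>\<^sup>+\<omega>. emeasure (distr (K (X \<omega>)) (N \<Otimes>\<^sub>M R) (Pair (X \<omega>))) U \<partial>M)"
    proof (rule nn_integral_cong)
      fix \<omega> assume \<omega>: "\<omega> \<in> space M"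
      then have X\<omega>: "X \<omega> \<in> space N"
        using measurable_space[OF \<open>X \<in> measurable M N\<close>] by blast
      interpret K: finite_measure "K (X \<omega>)"
        using sets_K[OF X\<omega>] by simp
      have [measurable]: "Pair (X \<omega>) \<in> measurable (K (X \<omega>)) (N \<Otimes>\<^sub>M R)"
        using sets_K(1)[OF X\<omega>] X\<omega> by (simp cong: measurable_cong_sets)
      have "Pair (X \<omega>) -` U \<inter> space (K (X \<omega>)) = (if X \<omega> \<in> A then B else {})"
        using sets.sets_into_space[OF B] sets_eq_imp_space_eq[OF sets_K(1)[OF X\<omega>]] by (auto simp: U)
      then show "ennreal (?a \<omega> * measure (K (X \<omega>)) B)
          = emeasure (distr (K (X \<omega>)) (N \<Otimes>\<^sub>M R) (Pair (X \<omega>))) U"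
        using \<omega> by (simp add: emeasure_distr U K.emeasure_eq_measure indicator_def)
    qed
    also have "\<dots> = emeasure ?B U"
      by (rule emeasure_bind[symmetric, where N = "N \<Otimes>\<^sub>M R"]) (auto simp: U not_empty)
    finally show "emeasure ?J U = emeasure ?B U" .
  qed
qed

text \<open>The hypothesis on \<open>Y\<close> concerns conditional probabilities of fixed events; a function that depends
  on the random \<open>X\<close> as well is reached through the joint law.\<close>

lemma (in prob_space) expectation_given_past:
  fixes h :: "'b \<times> 'c \<Rightarrow> real"
  assumes F: "subalgebra M F"
    and X: "X \<in> measurable F N" and Y: "Y \<in> measurable M R"
    and K: "K \<in> measurable N (subprob_algebra R)"
    and cond: "\<And>B. B \<in> sets R \<Longrightarrow>
      AE \<omega> in M. real_cond_exp M F (indicator (Y -` B \<inter> space M)) \<omega> = measure (K (X \<omega>)) B"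
    and h[measurable]: "h \<in> borel_measurable (N \<Otimes>\<^sub>M R)"
    and bound: "\<And>u. u \<in> space (N \<Otimes>\<^sub>M R) \<Longrightarrow> \<bar>h u\<bar> \<le> C"
  shows "expectation (\<lambda>\<omega>. h (X \<omega>, Y \<omega>)) = expectation (\<lambda>\<omega>. \<integral>y. h (X \<omega>, y) \<partial>K (X \<omega>))"
    and "integrable M (\<lambda>\<omega>. \<integral>y. h (X \<omega>, y) \<partial>K (X \<omega>))"
proof -
  have XM[measurable]: "X \<in> measurable M N"
    using measurable_from_subalg[OF F X] .
  note Y[measurable] K[measurable]
  have kernel[measurable]: "(\<lambda>\<omega>. distr (K (X \<omega>)) (N \<Otimes>\<^sub>M R) (Pair (X \<omega>)))
      \<in> measurable M (subprob_algebra (N \<Otimes>\<^sub>M R))"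
    by (rule measurable_distr2[where M = R]) measurable
  have sets_K: "sets (K x) = sets R" "subprob_space (K x)" if "x \<in> space N" for x
    using measurable_space[OF K that] by (auto simp: space_subprob_algebra)
  have inner: "(\<integral>u. h u \<partial>distr (K (X \<omega>)) (N \<Otimes>\<^sub>M R) (Pair (X \<omega>))) = (\<integral>y. h (X \<omega>, y) \<partial>K (X \<omega>))"
    if "\<omega> \<in> space M" for \<omega>
  proof -
    have X\<omega>: "X \<omega> \<in> space N"
      using measurable_space[OF XM that] .
    show ?thesis
      using sets_K(1)[OF X\<omega>] X\<omega> by (intro integral_distr) (auto cong: measurable_cong_sets)
  qed
  have J: "distr M (N \<Otimes>\<^sub>M R) (\<lambda>\<omega>. (X \<omega>, Y \<omega>))
      = M \<bind> (\<lambda>\<omega>. distr (K (X \<omega>)) (N \<Otimes>\<^sub>M R) (Pair (X \<omega>)))"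
    using cond by (rule joint_distr_eq_bind[OF F X Y K])
  have "expectation (\<lambda>\<omega>. h (X \<omega>, Y \<omega>)) = (\<integral>u. h u \<partial>distr M (N \<Otimes>\<^sub>M R) (\<lambda>\<omega>. (X \<omega>, Y \<omega>)))"
    by (simp add: integral_distr)
  also have "\<dots> = (\<integral>\<omega>. \<integral>u. h u \<partial>distr (K (X \<omega>)) (N \<Otimes>\<^sub>M R) (Pair (X \<omega>)) \<partial>M)"
    unfolding J
  proof (rule integral_bind[OF h bound kernel finite_measure_axioms, where B' = 1])
    show "AE \<omega> in M. emeasure (distr (K (X \<omega>)) (N \<Otimes>\<^sub>M R) (Pair (X \<omega>)))
        (space (distr (K (X \<omega>)) (N \<Otimes>\<^sub>M R) (Pair (X \<omega>)))) \<le> ennreal 1"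
      using subprob_space.emeasure_space_le_1[OF subprob_space_kernel[OF kernel]] by (auto simp del: space_distr)
  qed
  also have "\<dots> = expectation (\<lambda>\<omega>. \<integral>y. h (X \<omega>, y) \<partial>K (X \<omega>))"
    by (intro Bochner_Integration.integral_cong refl inner)
  finally show "expectation (\<lambda>\<omega>. h (X \<omega>, Y \<omega>)) = expectation (\<lambda>\<omega>. \<integral>y. h (X \<omega>, y) \<partial>K (X \<omega>))" .
  have meas: "(\<lambda>\<omega>. \<integral>y. h (X \<omega>, y) \<partial>K (X \<omega>)) \<in> borel_measurable M"
    using measurable_compose[OF kernel integral_measurable_subprob_algebra[OF h]] inner
    by (simp cong: measurable_cong)
  show "integrable M (\<lambda>\<omega>. \<integral>y. h (X \<omega>, y) \<partial>K (X \<omega>))"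
  proof (rule integrable_const_bound[OF AE_I2 meas])
    fix \<omega> assume "\<omega> \<in> space M"
    then have X\<omega>: "X \<omega> \<in> space N"
      using measurable_space[OF XM] by blast
    interpret K: subprob_space "K (X \<omega>)"
      by (rule sets_K(2)[OF X\<omega>])
    have hC: "\<bar>h (X \<omega>, y)\<bar> \<le> C" if "y \<in> space (K (X \<omega>))" for y
      using bound[of "(X \<omega>, y)"] that X\<omega> sets_eq_imp_space_eq[OF sets_K(1)[OF X\<omega>]]
      by (simp add: space_pair_measure)
    have C: "0 \<le> C"
      using hC K.subprob_not_empty by force
    have "\<bar>\<integral>y. h (X \<omega>, y) \<partial>K (X \<omega>)\<bar> \<le> (\<integral>y. \<bar>h (X \<omega>, y)\<bar> \<partial>K (X \<omega>))"
      by (rule integral_abs_bound)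
    also have "\<dots> \<le> (\<integral>y. C \<partial>K (X \<omega>))"
      using hC C by (intro integral_mono') auto
    also have "\<dots> \<le> C"
      using C K.subprob_measure_le_1[of "space (K (X \<omega>))"] by (simp add: mult_right_le_one_le mult_left_le_one_le)
    finally show "norm (\<integral>y. h (X \<omega>, y) \<partial>K (X \<omega>)) \<le> C"
      by simp
  qed
qed

lemma space_past [simp]: "space (past M \<theta>0 Z t) = space M"
  unfolding past_def by (rule space_measure_of) auto

lemma sets_past:
  "sets (past M \<theta>0 Z t) = sigma_sets (space M)
     ({\<theta>0 -` A \<inter> space M | A. A \<in> sets borel} \<union>
      {Z s -` A \<inter> space M | s A. s \<in> {1..t} \<and> A \<in> sets borel})"
  unfolding past_def by (rule sets_measure_of) auto

lemma measurable_past_initial: "\<theta>0 \<in> measurable (past M \<theta>0 Z t) borel"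
  by (rule measurableI) (auto simp: sets_past intro!: sigma_sets.Basic)

lemma measurable_past_draw:
  "s \<in> {1..t} \<Longrightarrow> Z s \<in> measurable (past M \<theta>0 Z t) borel"
  by (rule measurableI) (auto simp: sets_past intro!: sigma_sets.Basic)

lemma subalgebra_past:
  assumes "\<theta>0 \<in> borel_measurable M" "\<And>s. s \<in> {1..t} \<Longrightarrow> Z s \<in> borel_measurable M"
  shows "subalgebra M (past M \<theta>0 Z t)"
  unfolding subalgebra_def sets_past
  using assms by (auto intro!: sets.sigma_sets_subset measurable_sets)

section \<open>Risks under a shifting distribution\<close>

locale shifting_risk =
  fixes S :: "'z::euclidean_space set"
    and D :: "'a::euclidean_space \<Rightarrow> 'z measure"
    and loss :: "'a \<Rightarrow> 'z \<Rightarrow> real"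
    and L G \<beta> lmax :: real
  assumes D_prob: "\<And>x. prob_space (D x)"
    and D_sets: "\<And>x. sets (D x) = sets (restrict_space borel S)"
    and loss_measurable: "\<And>x. loss x \<in> borel_measurable (restrict_space borel S)"
    and loss_differentiable: "\<And>x z. z \<in> S \<Longrightarrow> (\<lambda>y. loss y z) differentiable (at x)"
    and L_pos: "L > 0"
    and L_smooth: "\<And>x1 x2 z1 z2. z1 \<in> S \<Longrightarrow> z2 \<in> S \<Longrightarrow>
          norm (grad_loss loss x1 z1 - grad_loss loss x2 z2) \<le> L * (norm (x1 - x2) + norm (z1 - z2))"
    and grad_loss_bound: "\<And>x z. z \<in> S \<Longrightarrow> norm (grad_loss loss x z) \<le> G"
    and \<beta>_nonneg: "\<beta> \<ge> 0"
    and TV: "\<And>x x'. tv_dist (D x) (D x') \<le> \<beta> * norm (x - x')"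
    and loss_bound: "\<And>x z. z \<in> S \<Longrightarrow> \<bar>loss x z\<bar> \<le> lmax"
begin

lemma space_D [simp]: "space (D x) = S"
  using sets_eq_imp_space_eq[OF D_sets[of x]] by (simp add: space_restrict_space)

lemma measure_D_S [simp]: "measure (D x) S = 1"
  using prob_space.prob_space[OF D_prob, of x] by simp

lemma measurable_D [measurable_cong]: "sets (D x) = sets (restrict_space borel S)"
  by (rule D_sets)

lemma lmax_nonneg: "0 \<le> lmax"
  using loss_bound prob_space.not_empty[OF D_prob] by force

text \<open>A Lipschitz bound in total variation makes every \<open>x \<mapsto> D x A\<close> Lipschitz, hence Borel; so drawing
  from \<open>D\<close> at a random parameter makes sense.\<close>

lemma kernel_D: "D \<in> measurable borel (subprob_algebra (restrict_space borel S))"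
proof (rule measurable_subprob_algebra)
  fix A assume A: "A \<in> sets (restrict_space borel S)"
  have "\<beta>-lipschitz_on UNIV (\<lambda>x. measure (D x) A)"
  proof (rule lipschitz_onI)
    show "dist (measure (D x) A) (measure (D y) A) \<le> \<beta> * dist x y" for x y
      using measure_le_tv_dist[OF D_prob D_prob, of A x y] TV[of x y] A
      by (simp add: dist_norm D_sets)
  qed (rule \<beta>_nonneg)
  then have "(\<lambda>x. measure (D x) A) \<in> borel_measurable borel"
    by (intro borel_measurable_continuous_onI lipschitz_on_continuous_on)
  then show "(\<lambda>x. emeasure (D x) A) \<in> borel_measurable borel"
    using D_prob by (simp add: prob_space.axioms finite_measure.emeasure_eq_measure)
qed (auto simp: D_sets D_prob prob_space_imp_subprob_space)

text \<open>Joint measurability rests on Lipschitz continuity in the pair, which holds on \<open>UNIV \<times> S\<close> only.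
  As \<open>S\<close> may be any set, the restriction to \<open>S\<close> is carried along as a subspace of the product.\<close>

lemma grad_loss_measurable_pair:
  "(\<lambda>(x, z). grad_loss loss x z) \<in> borel_measurable (borel \<Otimes>\<^sub>M restrict_space borel S)"
proof -
  let ?F = "\<lambda>p. grad_loss loss (fst p) (snd p)"
  have "(2 * L)-lipschitz_on (UNIV \<times> S) ?F"
  proof (rule lipschitz_onI)
    fix p q :: "'a \<times> 'z" assume "p \<in> UNIV \<times> S" "q \<in> UNIV \<times> S"
    then have "dist (?F p) (?F q) \<le> L * (dist (fst p) (fst q) + dist (snd p) (snd q))"
      using L_smooth by (auto simp: dist_norm)
    also have "\<dots> \<le> L * (dist p q + dist p q)"
      using L_pos by (intro mult_left_mono add_mono dist_fst_le dist_snd_le) auto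
    finally show "dist (?F p) (?F q) \<le> 2 * L * dist p q"
      by simp
  qed (use L_pos in simp)
  then have "continuous_on (UNIV \<times> S) ?F"
    by (rule lipschitz_on_continuous_on)
  then have F: "?F \<in> borel_measurable (restrict_space borel (UNIV \<times> S))"
    by (rule borel_measurable_continuous_on_restrict)
  have "(\<lambda>p. p) \<in> measurable ((borel :: 'a measure) \<Otimes>\<^sub>M restrict_space borel S) (restrict_space borel (UNIV \<times> S))"
  proof (rule measurable_restrict_space2)
    have "snd \<in> measurable ((borel :: 'a measure) \<Otimes>\<^sub>M restrict_space borel S) borel"
      using measurable_snd by (rule measurable_compose) (rule measurable_restrict_space1, simp)
    then have "(\<lambda>p. (fst p, snd p)) \<in> borel_measurable ((borel :: 'a measure) \<Otimes>\<^sub>M restrict_space (borel :: 'z measure) S)"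
      by (intro borel_measurable_Pair) auto
    then show "(\<lambda>p. p) \<in> borel_measurable ((borel :: 'a measure) \<Otimes>\<^sub>M restrict_space (borel :: 'z measure) S)"
      by simp
  qed (auto simp: space_pair_measure space_restrict_space)
  from measurable_compose[OF this F] show ?thesis
    by (simp add: case_prod_beta')
qed

lemma grad_loss_measurable [measurable]:
  "grad_loss loss x \<in> borel_measurable (restrict_space borel S)"
  using measurable_compose[OF measurable_Pair1' grad_loss_measurable_pair, of x] by simp

declare loss_measurable [measurable]

lemma integrable_loss [simp]: "integrable (D \<theta>) (loss x)"
proof -
  interpret D: prob_space "D \<theta>" by (rule D_prob)
  show ?thesis
    using loss_bound by (intro D.integrable_const_bound[where B = lmax] AE_I2) auto
qed

lemma integrable_grad_loss [simp]: "integrable (D \<theta>) (grad_loss loss x)"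
proof -
  interpret D: prob_space "D \<theta>" by (rule D_prob)
  show ?thesis
    using grad_loss_bound by (intro D.integrable_const_bound[where B = G] AE_I2) auto
qed

lemma abs_risk_le: "\<bar>risk D loss x \<theta>\<bar> \<le> lmax"
proof -
  interpret D: prob_space "D \<theta>" by (rule D_prob)
  have "\<bar>\<integral>z. loss x z \<partial>D \<theta>\<bar> \<le> (\<integral>z. \<bar>loss x z\<bar> \<partial>D \<theta>)"
    by (rule integral_abs_bound)
  also have "\<dots> \<le> (\<integral>z. lmax \<partial>D \<theta>)"
    using loss_bound lmax_nonneg by (intro integral_mono') auto
  finally show ?thesis
    by (simp add: D.prob_space risk_def)
qed

lemma GDERIV_loss: "z \<in> S \<Longrightarrow> GDERIV (\<lambda>x. loss x z) x :> grad_loss loss x z"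
  unfolding grad_loss_def by (intro GDERIV_grad loss_differentiable)

text \<open>The pointwise quadratic approximation of the loss integrates to one for the risk. It serves twice:
  it identifies the gradient of the risk, and it is the descent inequality of a step.\<close>

lemma risk_quadratic_approximation:
  "\<bar>risk D loss y \<theta> - risk D loss x \<theta> - (\<integral>z. grad_loss loss x z \<partial>D \<theta>) \<bullet> (y - x)\<bar>
    \<le> L / 2 * (norm (y - x))\<^sup>2"
proof -
  interpret D: prob_space "D \<theta>" by (rule D_prob)
  have "risk D loss y \<theta> - risk D loss x \<theta> - (\<integral>z. grad_loss loss x z \<partial>D \<theta>) \<bullet> (y - x)
      = (\<integral>z. loss y z - loss x z - grad_loss loss x z \<bullet> (y - x) \<partial>D \<theta>)"
    by (simp add: risk_def)
  also have "\<bar>\<dots>\<bar> \<le> (\<integral>z. \<bar>loss y z - loss x z - grad_loss loss x z \<bullet> (y - x)\<bar> \<partial>D \<theta>)"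
    by (rule integral_abs_bound)
  also have "\<dots> \<le> (\<integral>z. L / 2 * (norm (y - x))\<^sup>2 \<partial>D \<theta>)"
  proof (rule integral_mono')
    fix z assume "z \<in> space (D \<theta>)"
    then have z: "z \<in> S" by simp
    show "\<bar>loss y z - loss x z - grad_loss loss x z \<bullet> (y - x)\<bar> \<le> L / 2 * (norm (y - x))\<^sup>2"
      using L_smooth[OF z z] by (intro quadratic_approximation GDERIV_loss[OF z]) simp
  qed (use L_pos in auto)
  finally show ?thesis
    by (simp add: D.prob_space)
qed

lemma GDERIV_risk: "GDERIV (\<lambda>x. risk D loss x \<theta>) x :> (\<integral>z. grad_loss loss x z \<partial>D \<theta>)"
  using risk_quadratic_approximation by (rule GDERIV_of_quadratic_approximation)

lemma grad_risk_eq: "grad_risk D loss x \<theta> = (\<integral>z. grad_loss loss x z \<partial>D \<theta>)"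
  unfolding grad_risk_def by (rule grad_eqI[OF GDERIV_risk])

text \<open>The price of redeploying: a change of the sampling parameter alone moves the risk by this much.\<close>

lemma risk_shift: "risk D loss y x - risk D loss y x' \<le> 2 * lmax * \<beta> * norm (x - x')"
proof -
  have "risk D loss y x - risk D loss y x' \<le> 2 * lmax * tv_dist (D x) (D x')"
    unfolding risk_def using loss_bound D_sets
    by (intro integral_diff_le_tv_dist D_prob) auto
  also have "\<dots> \<le> 2 * lmax * (\<beta> * norm (x - x'))"
    using TV lmax_nonneg by (intro mult_left_mono) auto
  finally show ?thesis
    by (simp add: mult.assoc)
qed

text \<open>The gradient of the risk takes care of the first argument and \<open>risk_shift\<close>, being uniform in
  the first argument, of the second. Only the measurability of \<open>x \<mapsto> risk D loss x x\<close> is wanted from this.\<close>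

lemma continuous_deployed_risk: "isCont (\<lambda>x. risk D loss x x) x"
proof -
  have "isCont (\<lambda>y. risk D loss y x) x"
    using GDERIV_risk[of x x] by (auto simp: gderiv_def dest: has_derivative_continuous)
  then have 1: "((\<lambda>y. risk D loss y x) \<longlongrightarrow> risk D loss x x) (at x)"
    by (simp add: isCont_def)
  have 2: "((\<lambda>y. risk D loss y y - risk D loss y x) \<longlongrightarrow> 0) (at x)"
  proof (rule Lim_null_comparison)
    have "\<bar>risk D loss y y - risk D loss y x\<bar> \<le> 2 * lmax * \<beta> * norm (y - x)" for y
      using risk_shift[of y y x] risk_shift[of y x y] by (simp add: norm_minus_commute abs_le_iff)
    then show "\<forall>\<^sub>F y in at x. norm (risk D loss y y - risk D loss y x) \<le> 2 * lmax * \<beta> * norm (y - x)"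
      by simp
    show "((\<lambda>y. 2 * lmax * \<beta> * norm (y - x)) \<longlongrightarrow> 0) (at x)"
      by (auto intro!: tendsto_eq_intros)
  qed
  show ?thesis
    using tendsto_add[OF 1 2] by (simp add: isCont_def)
qed

lemma deployed_risk_measurable [measurable]: "(\<lambda>x. risk D loss x x) \<in> borel_measurable borel"
  by (rule borel_measurable_continuous_onI) (simp add: continuous_at_imp_continuous_on continuous_deployed_risk)

text \<open>One step from a fixed \<open>x\<close>. Write \<open>n\<close> for the norm of the gradient at \<open>x\<close>, \<open>b\<close> for \<open>max (G - c) 0\<close>,
  \<open>k\<close> for \<open>lmax * \<beta>\<close> and \<open>q\<close> for \<open>1 + \<sigma>1\<^sup>2\<close>. Per unit of step size, the descent inequality gains \<open>n\<^sup>2\<close>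
  and three costs each eat up at most a quarter of it:
  clipping biases the mean direction by at most \<open>b\<close> and costs \<open>n b \<le> n\<^sup>2/4 + b\<^sup>2\<close>;
  the second moment of the direction is at most \<open>\<sigma>0\<^sup>2 + q n\<^sup>2\<close>, whose second part costs at most
  \<open>n\<^sup>2/4\<close> by the bound on the step size;
  the shift of the distribution costs \<open>2 k\<close> times the mean length of the direction, at most
  \<open>2 k (\<sigma>0 + \<surd>q n) \<le> 2 k \<sigma>0 + n\<^sup>2/4 + 4 q k\<^sup>2\<close>.
  A quarter of \<open>n\<^sup>2\<close> remains, and the other terms are within twice the bias \<open>clip_bias\<close>.\<close>

lemma clipped_step_decrease:
  assumes c: "0 \<le> c" and \<gamma>: "0 < \<gamma>" "\<gamma> \<le> 1 / (2 * L * (1 + \<sigma>1\<^sup>2))"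
    and \<sigma>: "0 \<le> \<sigma>0"
    and V: "(\<integral>z. (norm (grad_loss loss x z - grad_risk D loss x x))\<^sup>2 \<partial>D x)
          \<le> \<sigma>0\<^sup>2 + \<sigma>1\<^sup>2 * (norm (grad_risk D loss x x))\<^sup>2"
  defines "step z \<equiv> x - \<gamma> *\<^sub>R clip c (grad_loss loss x z)"
  shows "\<gamma> / 4 * (norm (grad_risk D loss x x))\<^sup>2
    \<le> risk D loss x x - (\<integral>z. risk D loss (step z) (step z) \<partial>D x)
      + L / 2 * \<sigma>0\<^sup>2 * \<gamma>\<^sup>2 + 2 * clip_bias lmax \<sigma>0 \<sigma>1 G \<beta> c * \<gamma>"
proof -
  interpret D: prob_space "D x" by (rule D_prob)
  define g where "g = grad_loss loss x"
  define \<mu> where "\<mu> = grad_risk D loss x x"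
  define gc where "gc = (\<lambda>z. clip c (g z))"
  define k where "k = lmax * \<beta>"
  define b where "b = max (G - c) 0"
  define q where "q = 1 + \<sigma>1\<^sup>2"
  define n where "n = norm \<mu>"
  define m where "m = (\<integral>z. norm (gc z) \<partial>D x)"
  define Q where "Q = (\<integral>z. (norm (gc z))\<^sup>2 \<partial>D x)"
  have g_meas[measurable]: "g \<in> borel_measurable (restrict_space borel S)"
    by (simp add: g_def)
  have gc_meas[measurable]: "gc \<in> borel_measurable (restrict_space borel S)"
    unfolding gc_def by measurable
  have \<mu>: "\<mu> = (\<integral>z. g z \<partial>D x)"
    by (simp add: \<mu>_def g_def grad_risk_eq)
  have gG: "norm (g z) \<le> G" if "z \<in> S" for z
    using grad_loss_bound[OF that] by (simp add: g_def)
  have gcg: "norm (gc z) \<le> norm (g z)" for z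
    unfolding gc_def using c by (rule norm_clip_le)
  have gcG: "norm (gc z) \<le> G" if "z \<in> S" for z
    using gcg[of z] gG[OF that] by simp
  have k: "0 \<le> k" and q: "1 \<le> q" and n: "0 \<le> n"
    using lmax_nonneg \<beta>_nonneg by (auto simp: k_def q_def n_def)
  have int_g[simp]: "integrable (D x) g"
    unfolding g_def by simp
  have int_gc[simp]: "integrable (D x) gc"
    using gcG by (intro D.integrable_const_bound[where B = G] AE_I2) auto
  have int_g2: "integrable (D x) (\<lambda>z. (norm (g z))\<^sup>2)" and int_gc2: "integrable (D x) (\<lambda>z. (norm (gc z))\<^sup>2)"
    using gcG gG by (intro D.integrable_const_bound[where B = "G\<^sup>2"] AE_I2; auto intro!: power_mono)+

  \<comment> \<open>Clipping moves a single gradient by \<open>max (norm - c) 0\<close>, so the mean moves by at most \<open>b\<close>.\<close>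
  have clip_error: "\<mu> \<bullet> (\<integral>z. gc z \<partial>D x) \<ge> n\<^sup>2 - n * b"
  proof -
    have "norm (\<mu> - (\<integral>z. gc z \<partial>D x)) = norm (\<integral>z. g z - gc z \<partial>D x)"
      by (simp add: \<mu>)
    also have "\<dots> \<le> (\<integral>z. norm (g z - gc z) \<partial>D x)"
      by (rule integral_norm_bound)
    also have "\<dots> \<le> (\<integral>z. b \<partial>D x)"
    proof (rule integral_mono')
      fix z assume "z \<in> space (D x)"
      then show "norm (g z - gc z) \<le> b"
        using gG[of z] by (simp add: gc_def b_def norm_diff_clip[OF c] max.coboundedI1)
    qed (simp_all add: b_def)
    finally have "norm (\<mu> - (\<integral>z. gc z \<partial>D x)) \<le> b"
      by (simp add: D.prob_space)
    then have "\<mu> \<bullet> (\<mu> - (\<integral>z. gc z \<partial>D x)) \<le> n * b"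
      using norm_cauchy_schwarz[of \<mu> "\<mu> - (\<integral>z. gc z \<partial>D x)"] mult_left_mono[OF _ n]
      by (fastforce simp: n_def)
    then show ?thesis
      by (simp add: n_def inner_diff_right power2_norm_eq_inner)
  qed

  \<comment> \<open>Clipping only shortens, and the second moment of the gradient is its variance plus \<open>n\<^sup>2\<close>.\<close>
  have Q_le: "Q \<le> \<sigma>0\<^sup>2 + q * n\<^sup>2"
  proof -
    have "Q \<le> (\<integral>z. (norm (g z))\<^sup>2 \<partial>D x)"
      unfolding Q_def using int_g2 gcg by (intro integral_mono') (auto intro: power_mono)
    also have "\<dots> = (\<integral>z. (norm (g z - \<mu>))\<^sup>2 \<partial>D x) + n\<^sup>2"
    proof -
      have "(norm (g z - \<mu>))\<^sup>2 = (norm (g z))\<^sup>2 - 2 * (g z \<bullet> \<mu>) + n\<^sup>2" for z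
        by (simp add: n_def power2_norm_eq_inner inner_diff_left inner_diff_right inner_commute)
      then have "(\<integral>z. (norm (g z - \<mu>))\<^sup>2 \<partial>D x) = (\<integral>z. (norm (g z))\<^sup>2 \<partial>D x) - 2 * (\<mu> \<bullet> \<mu>) + n\<^sup>2"
        using int_g2 by (simp add: D.prob_space \<mu>)
      then show ?thesis
        by (simp add: n_def power2_norm_eq_inner)
    qed
    also have "\<dots> \<le> \<sigma>0\<^sup>2 + q * n\<^sup>2"
      using V by (simp add: g_def \<mu>_def n_def q_def algebra_simps)
    finally show ?thesis .
  qed

  have m_le: "m \<le> \<sigma>0 + sqrt q * n"
  proof (rule power2_le_imp_le)
    have "m\<^sup>2 \<le> Q"
      using D.variance_eq[of "\<lambda>z. norm (gc z)"] int_gc2 D.variance_positive[of "\<lambda>z. norm (gc z)"]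
      by (simp add: m_def Q_def)
    also note Q_le
    also have "\<sigma>0\<^sup>2 + q * n\<^sup>2 \<le> (\<sigma>0 + sqrt q * n)\<^sup>2"
      using q n \<sigma> by (simp add: power2_sum power_mult_distrib)
    finally show "m\<^sup>2 \<le> (\<sigma>0 + sqrt q * n)\<^sup>2" .
  qed (use q n \<sigma> in simp)

  \<comment> \<open>First the move at the old distribution \<open>D x\<close>, then the change of distribution at the new point.\<close>
  have "(\<integral>z. risk D loss (step z) (step z) \<partial>D x)
      \<le> (\<integral>z. risk D loss x x - \<gamma> * (gc z \<bullet> \<mu>) + L / 2 * \<gamma>\<^sup>2 * (norm (gc z))\<^sup>2 + 2 * k * \<gamma> * norm (gc z) \<partial>D x)"
  proof (rule integral_mono)
    have "step \<in> borel_measurable (restrict_space borel S)"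
      unfolding step_def by measurable
    then show "integrable (D x) (\<lambda>z. risk D loss (step z) (step z))"
      using abs_risk_le by (intro D.integrable_const_bound[where B = lmax] AE_I2) auto
    fix z
    have step: "step z - x = - (\<gamma> *\<^sub>R gc z)"
      by (simp add: step_def gc_def g_def)
    have "risk D loss (step z) (step z) \<le> risk D loss (step z) x + 2 * k * (\<gamma> * norm (gc z))"
      using risk_shift[of "step z" "step z" x] \<gamma> by (simp add: step k_def)
    also have "risk D loss (step z) x \<le> risk D loss x x - \<gamma> * (gc z \<bullet> \<mu>) + L / 2 * \<gamma>\<^sup>2 * (norm (gc z))\<^sup>2"
      using abs_le_D1[OF risk_quadratic_approximation[of "step z" x x]] \<gamma>
      by (simp add: step grad_risk_eq[symmetric] \<mu>_def power_mult_distrib inner_commute)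
    finally show "risk D loss (step z) (step z)
      \<le> risk D loss x x - \<gamma> * (gc z \<bullet> \<mu>) + L / 2 * \<gamma>\<^sup>2 * (norm (gc z))\<^sup>2 + 2 * k * \<gamma> * norm (gc z)"
      by simp
  qed (use int_gc2 in simp)
  also have "\<dots> = risk D loss x x - \<gamma> * (\<mu> \<bullet> (\<integral>z. gc z \<partial>D x)) + L / 2 * \<gamma>\<^sup>2 * Q + 2 * k * \<gamma> * m"
    using int_gc2 by (simp add: D.prob_space Q_def m_def inner_commute)
  also have "\<dots> \<le> risk D loss x x - \<gamma> * (n\<^sup>2 - n * b) + (L / 2 * \<sigma>0\<^sup>2 * \<gamma>\<^sup>2 + \<gamma> / 4 * n\<^sup>2)
      + 2 * k * \<gamma> * (\<sigma>0 + sqrt q * n)"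
  proof (intro add_mono diff_mono mult_left_mono order_refl clip_error m_le)
    have "L * \<gamma> * q \<le> 1 / 2"
      using \<gamma>(2) L_pos q by (simp add: q_def[symmetric] field_simps)
    then have "\<gamma> / 2 * n\<^sup>2 * (L * \<gamma> * q) \<le> \<gamma> / 2 * n\<^sup>2 * (1 / 2)"
      using \<gamma> by (intro mult_left_mono) auto
    moreover have "L / 2 * \<gamma>\<^sup>2 * Q \<le> L / 2 * \<gamma>\<^sup>2 * (\<sigma>0\<^sup>2 + q * n\<^sup>2)"
      using L_pos by (intro mult_left_mono Q_le) auto
    ultimately show "L / 2 * \<gamma>\<^sup>2 * Q \<le> L / 2 * \<sigma>0\<^sup>2 * \<gamma>\<^sup>2 + \<gamma> / 4 * n\<^sup>2"
      by (simp add: power2_eq_square algebra_simps)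
  qed (use \<gamma> k in auto)
  also have "\<dots> \<le> risk D loss x x - \<gamma> / 4 * n\<^sup>2 + L / 2 * \<sigma>0\<^sup>2 * \<gamma>\<^sup>2
      + 2 * (k * (\<sigma>0 + 8 * q * k) + 2 * b\<^sup>2) * \<gamma>"
  proof -
    have 1: "n * b \<le> n\<^sup>2 / 4 + b\<^sup>2"
      using zero_le_power2[of "n / 2 - b"] by (simp add: power2_diff power_divide)
    \<comment> \<open>\<open>u v \<le> u\<^sup>2/4 + v\<^sup>2\<close> for \<open>u = n\<close> and \<open>v = 2 k \<surd>q\<close>.\<close>
    have "0 \<le> (n / 2 - 2 * (k * sqrt q))\<^sup>2"
      by simp
    also have "\<dots> = n\<^sup>2 / 4 - 2 * k * (sqrt q * n) + 4 * q * k\<^sup>2"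
      using q by (simp add: power2_diff power_divide power_mult_distrib)
    finally have 2: "2 * k * (sqrt q * n) \<le> n\<^sup>2 / 4 + 4 * q * k\<^sup>2"
      by simp
    have "n * b + 2 * k * (\<sigma>0 + sqrt q * n) \<le> n\<^sup>2 / 2 + 2 * (k * (\<sigma>0 + 8 * q * k) + 2 * b\<^sup>2)"
    proof -
      have "0 \<le> q * k\<^sup>2"
        using q by simp
      moreover have "2 * (k * (\<sigma>0 + 8 * q * k) + 2 * b\<^sup>2) = 2 * k * \<sigma>0 + 16 * (q * k\<^sup>2) + 4 * b\<^sup>2"
        by (simp add: algebra_simps power2_eq_square)
      ultimately show ?thesis
        using 1 2 zero_le_power2[of b] unfolding distrib_left[of "2 * k"] by linarith
    qed
    then have "\<gamma> * (n * b + 2 * k * (\<sigma>0 + sqrt q * n))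
        \<le> \<gamma> * (n\<^sup>2 / 2 + 2 * (k * (\<sigma>0 + 8 * q * k) + 2 * b\<^sup>2))"
      using \<gamma> by (intro mult_left_mono) auto
    then show ?thesis
      by (simp add: algebra_simps)
  qed
  also have "k * (\<sigma>0 + 8 * q * k) + 2 * b\<^sup>2 = clip_bias lmax \<sigma>0 \<sigma>1 G \<beta> c"
    by (simp add: clip_bias_def k_def q_def b_def mult.assoc)
  finally show ?thesis
    unfolding n_def \<mu>_def by linarith
qed

end

section \<open>Convergence of clipped SGD\<close>

theorem theorem5:
  fixes S :: "'z::euclidean_space set"
    and D :: "real ^ 'd \<Rightarrow> 'z measure"
    and loss :: "real ^ 'd \<Rightarrow> 'z \<Rightarrow> real"
    and L lstar G \<sigma>0 \<sigma>1 \<beta> lmax c :: real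
    and \<gamma> :: "nat \<Rightarrow> real"
    and M :: "'w measure"
    and \<theta> :: "nat \<Rightarrow> 'w \<Rightarrow> real ^ 'd"
    and Z :: "nat \<Rightarrow> 'w \<Rightarrow> 'z"
    and T :: nat
  assumes D_prob: "\<And>x. prob_space (D x)"
    and D_sets: "\<And>x. sets (D x) = sets (restrict_space borel S)"
    and loss_measurable: "\<And>x. loss x \<in> borel_measurable (restrict_space borel S)"
    and loss_differentiable: "\<And>x z. z \<in> S \<Longrightarrow> (\<lambda>y. loss y z) differentiable (at x)"
    and L_pos: "L > 0"
    and L_smooth: "\<And>x1 x2 z1 z2. z1 \<in> S \<Longrightarrow> z2 \<in> S \<Longrightarrow>
          norm (grad_loss loss x1 z1 - grad_loss loss x2 z2) \<le> L * (norm (x1 - x2) + norm (z1 - z2))"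
    and L_lower: "\<And>x z. z \<in> S \<Longrightarrow> loss x z \<ge> lstar"
    and B: "\<And>x z. z \<in> S \<Longrightarrow> norm (grad_loss loss x z) \<le> G"
    and V_nonneg: "\<sigma>0 \<ge> 0" "\<sigma>1 \<ge> 0"
    and V: "\<And>x1 x2. (\<integral>z. (norm (grad_loss loss x1 z - grad_risk D loss x1 x2))\<^sup>2 \<partial>D x2)
          \<le> \<sigma>0\<^sup>2 + \<sigma>1\<^sup>2 * (norm (grad_risk D loss x1 x2))\<^sup>2"
    and TV_nonneg: "\<beta> \<ge> 0"
    and TV: "\<And>x x'. tv_dist (D x) (D x') \<le> \<beta> * norm (x - x')"
    and M_nonneg: "lmax \<ge> 0"
    and M: "\<And>x z. z \<in> S \<Longrightarrow> \<bar>loss x z\<bar> \<le> lmax"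
    and c_pos: "c > 0"
    and step_pos: "\<And>t. t \<ge> 1 \<Longrightarrow> \<gamma> t > 0"
    and step_le: "\<And>t. t \<ge> 1 \<Longrightarrow> \<gamma> t \<le> 1 / (2 * L * (1 + \<sigma>1\<^sup>2))"
    and T: "T \<ge> 1"
    and iterates: "clipped_SGD M S D loss \<gamma> c \<theta> Z"
  shows "(\<Sum>t<T. \<gamma> (t + 1) * (\<integral>\<omega>. (norm (grad_risk D loss (\<theta> t \<omega>) (\<theta> t \<omega>)))\<^sup>2 \<partial>M))
    \<le> 8 * (\<integral>\<omega>. risk D loss (\<theta> 0 \<omega>) (\<theta> 0 \<omega>) - lstar \<partial>M)
      + 4 * L * \<sigma>0\<^sup>2 * (\<Sum>t<T. (\<gamma> (t + 1))\<^sup>2)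
      + 8 * clip_bias lmax \<sigma>0 \<sigma>1 G \<beta> c * (\<Sum>t<T. \<gamma> (t + 1))"
proof -
  interpret shifting_risk S D loss L G \<beta> lmax
    by (rule shifting_risk.intro) (fact assms)+
  have prob_M: "prob_space M"
    and \<theta>0: "\<theta> 0 \<in> borel_measurable M"
    and Z: "\<And>t. Z (Suc t) \<in> measurable M (restrict_space borel S)"
    and cond: "\<And>t A. A \<in> sets (restrict_space borel S) \<Longrightarrow>
        AE \<omega> in M. real_cond_exp M (past M (\<theta> 0) Z t)
          (indicator (Z (Suc t) -` A \<inter> space M)) \<omega> = measure (D (\<theta> t \<omega>)) A"
    and update: "\<And>t \<omega>. \<omega> \<in> space M \<Longrightarrow>
        \<theta> (Suc t) \<omega> = \<theta> t \<omega> - \<gamma> (Suc t) *\<^sub>R clip c (grad_loss loss (\<theta> t \<omega>) (Z (Suc t) \<omega>))"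
    using iterates unfolding clipped_SGD_def by blast+
  interpret prob_space M
    by (rule prob_M)

  define R where "R = (\<lambda>x. risk D loss x x)"
  define next_R where "next_R = (\<lambda>t (x, z). R (x - \<gamma> (Suc t) *\<^sub>R clip c (grad_loss loss x z)))"
  have R_meas[measurable]: "R \<in> borel_measurable borel"
    unfolding R_def by measurable
  have R_bound: "\<bar>R x\<bar> \<le> lmax" for x
    unfolding R_def by (rule abs_risk_le)
  have next_R_meas: "next_R t \<in> borel_measurable (borel \<Otimes>\<^sub>M restrict_space borel S)" for t
  proof -
    have "(\<lambda>p. grad_loss loss (fst p) (snd p)) \<in> borel_measurable ((borel :: (real ^ 'd) measure) \<Otimes>\<^sub>M restrict_space borel S)"
      using grad_loss_measurable_pair by (simp add: case_prod_beta')
    then have "(\<lambda>p. R (fst p - \<gamma> (Suc t) *\<^sub>R clip c (grad_loss loss (fst p) (snd p))))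
        \<in> borel_measurable ((borel :: (real ^ 'd) measure) \<Otimes>\<^sub>M restrict_space borel S)"
      by measurable
    then show ?thesis
      by (simp add: next_R_def case_prod_beta')
  qed
  have next_R_bound: "\<bar>next_R t u\<bar> \<le> lmax" for t u
    using R_bound by (simp add: next_R_def split: prod.split)

  have subalg: "subalgebra M (past M (\<theta> 0) Z t)" for t
  proof (rule subalgebra_past[OF \<theta>0])
    fix s assume "s \<in> {1..t}"
    then obtain r where "s = Suc r"
      by (cases s) auto
    then show "Z s \<in> borel_measurable M"
      using Z[of r] by (auto simp: measurable_restrict_space2_iff)
  qed
  \<comment> \<open>Allowing every \<open>t \<ge> s\<close> keeps the induction from comparing pasts of different lengths.\<close>
  have \<theta>_past: "\<theta> s \<in> borel_measurable (past M (\<theta> 0) Z t)" if "s \<le> t" for s t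
    using that
  proof (induction s)
    case 0
    show ?case
      by (rule measurable_past_initial)
  next
    case (Suc s)
    let ?F = "past M (\<theta> 0) Z t"
    have [measurable]: "\<theta> s \<in> borel_measurable ?F"
      using Suc by simp
    have "Z (Suc s) \<in> borel_measurable ?F"
      using Suc.prems by (intro measurable_past_draw) auto
    then have [measurable]: "Z (Suc s) \<in> measurable ?F (restrict_space borel S)"
      using measurable_space[OF Z[of s]] by (auto simp: measurable_restrict_space2_iff space_restrict_space)
    have "(\<lambda>\<omega>. grad_loss loss (\<theta> s \<omega>) (Z (Suc s) \<omega>)) \<in> borel_measurable ?F"
      using measurable_compose[OF _ grad_loss_measurable_pair, of "\<lambda>\<omega>. (\<theta> s \<omega>, Z (Suc s) \<omega>)" ?F] by simp
    then have "(\<lambda>\<omega>. \<theta> s \<omega> - \<gamma> (Suc s) *\<^sub>R clip c (grad_loss loss (\<theta> s \<omega>) (Z (Suc s) \<omega>))) \<in> borel_measurable ?F"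
      by measurable
    then show ?case
      by (rule measurable_cong[THEN iffD2, rotated]) (simp add: update)
  qed
  have \<theta>_meas[measurable]: "\<theta> t \<in> borel_measurable M" for t
    using measurable_from_subalg[OF subalg \<theta>_past] by blast
  have R_int[simp]: "integrable M (\<lambda>\<omega>. R (\<theta> t \<omega>))" for t
    using R_bound by (intro integrable_const_bound[where B = lmax]) auto

  define err where "err = (\<lambda>t. L / 2 * \<sigma>0\<^sup>2 * (\<gamma> (t + 1))\<^sup>2 + 2 * clip_bias lmax \<sigma>0 \<sigma>1 G \<beta> c * \<gamma> (t + 1))"
  have step: "\<gamma> (t + 1) / 4 * expectation (\<lambda>\<omega>. (norm (grad_risk D loss (\<theta> t \<omega>) (\<theta> t \<omega>)))\<^sup>2)
      \<le> expectation (\<lambda>\<omega>. R (\<theta> t \<omega>)) - expectation (\<lambda>\<omega>. R (\<theta> (Suc t) \<omega>)) + err t" for t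
  proof -
    let ?E = "\<lambda>x. \<integral>z. next_R t (x, z) \<partial>D x"
    note given_past = expectation_given_past[OF subalg \<theta>_past[OF order_refl] Z kernel_D cond next_R_meas next_R_bound]
    have E_int: "integrable M (\<lambda>\<omega>. ?E (\<theta> t \<omega>))"
      and E_eq: "expectation (\<lambda>\<omega>. ?E (\<theta> t \<omega>)) = expectation (\<lambda>\<omega>. next_R t (\<theta> t \<omega>, Z (Suc t) \<omega>))"
      using given_past[of t t] by simp_all
    have pointwise: "\<gamma> (t + 1) / 4 * (norm (grad_risk D loss x x))\<^sup>2 \<le> R x - ?E x + err t" for x
      using clipped_step_decrease[OF _ _ _ V_nonneg(1) V, of c "\<gamma> (t + 1)" x] step_pos[of "t + 1"] step_le[of "t + 1"] c_pos
      by (simp add: R_def next_R_def err_def)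
    \<comment> \<open>A nonnegative integrable majorant bounds the integral on the left in every case: were the
      gradient at \<open>\<theta> t\<close> not measurable, that integral would be \<open>0\<close>.\<close>
    have "expectation (\<lambda>\<omega>. \<gamma> (t + 1) / 4 * (norm (grad_risk D loss (\<theta> t \<omega>) (\<theta> t \<omega>)))\<^sup>2)
        \<le> expectation (\<lambda>\<omega>. R (\<theta> t \<omega>) - ?E (\<theta> t \<omega>) + err t)"
    proof (rule integral_mono')
      show "integrable M (\<lambda>\<omega>. R (\<theta> t \<omega>) - ?E (\<theta> t \<omega>) + err t)"
        using E_int by simp
      show "0 \<le> R (\<theta> t \<omega>) - ?E (\<theta> t \<omega>) + err t" for \<omega>
        using step_pos[of "t + 1"] by (intro order_trans[OF _ pointwise]) auto
    qed (rule pointwise)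
    also have "\<dots> = expectation (\<lambda>\<omega>. R (\<theta> t \<omega>)) - expectation (\<lambda>\<omega>. ?E (\<theta> t \<omega>)) + err t"
      using E_int by (simp add: prob_space)
    also have "expectation (\<lambda>\<omega>. ?E (\<theta> t \<omega>)) = expectation (\<lambda>\<omega>. R (\<theta> (Suc t) \<omega>))"
      unfolding E_eq
      by (intro Bochner_Integration.integral_cong) (simp_all add: next_R_def update)
    finally show ?thesis
      by simp
  qed

  have R_lower: "lstar \<le> R x" for x
  proof -
    interpret D: prob_space "D x" by (rule D_prob)
    have "(\<integral>z. lstar \<partial>D x) \<le> (\<integral>z. loss x z \<partial>D x)"
      using L_lower by (intro integral_mono) auto
    then show ?thesis
      by (simp add: R_def risk_def)
  qed
  define \<Delta> where "\<Delta> = expectation (\<lambda>\<omega>. R (\<theta> 0 \<omega>) - lstar)"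
  have \<Delta>_nonneg: "0 \<le> \<Delta>"
    unfolding \<Delta>_def using R_lower by (intro integral_nonneg_AE) auto
  have final: "lstar \<le> expectation (\<lambda>\<omega>. R (\<theta> T \<omega>))"
    using integral_mono[of M "\<lambda>_. lstar" "\<lambda>\<omega>. R (\<theta> T \<omega>)"] R_lower by (simp add: prob_space)
  let ?lhs = "\<Sum>t<T. \<gamma> (t + 1) * expectation (\<lambda>\<omega>. (norm (grad_risk D loss (\<theta> t \<omega>) (\<theta> t \<omega>)))\<^sup>2)"
  \<comment> \<open>The bound obtained by telescoping has \<open>4 \<Delta>\<close> and \<open>2 L\<close>; it is then weakened to \<open>8 \<Delta>\<close> and \<open>4 L\<close>.\<close>
  have "?lhs / 4 \<le> (\<Sum>t<T. expectation (\<lambda>\<omega>. R (\<theta> t \<omega>)) - expectation (\<lambda>\<omega>. R (\<theta> (Suc t) \<omega>)) + err t)"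
    unfolding sum_divide_distrib using step by (intro sum_mono) simp
  also have "\<dots> = expectation (\<lambda>\<omega>. R (\<theta> 0 \<omega>)) - expectation (\<lambda>\<omega>. R (\<theta> T \<omega>)) + (\<Sum>t<T. err t)"
    unfolding sum.distrib sum_lessThan_telescope'[of "\<lambda>t. expectation (\<lambda>\<omega>. R (\<theta> t \<omega>))"] ..
  also have "\<dots> \<le> \<Delta> + (\<Sum>t<T. err t)"
    using final by (simp add: \<Delta>_def prob_space)
  also have "(\<Sum>t<T. err t) = L / 2 * \<sigma>0\<^sup>2 * (\<Sum>t<T. (\<gamma> (t + 1))\<^sup>2)
      + 2 * clip_bias lmax \<sigma>0 \<sigma>1 G \<beta> c * (\<Sum>t<T. \<gamma> (t + 1))"
    by (simp add: err_def sum.distrib sum_distrib_left)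
  finally have "?lhs \<le> 4 * \<Delta> + 2 * L * \<sigma>0\<^sup>2 * (\<Sum>t<T. (\<gamma> (t + 1))\<^sup>2)
      + 8 * clip_bias lmax \<sigma>0 \<sigma>1 G \<beta> c * (\<Sum>t<T. \<gamma> (t + 1))"
    by simp
  also have "\<dots> \<le> 8 * \<Delta> + 4 * L * \<sigma>0\<^sup>2 * (\<Sum>t<T. (\<gamma> (t + 1))\<^sup>2)
      + 8 * clip_bias lmax \<sigma>0 \<sigma>1 G \<beta> c * (\<Sum>t<T. \<gamma> (t + 1))"
    using \<Delta>_nonneg L_pos by (intro add_mono order_refl mult_right_mono) (auto intro!: sum_nonneg)
  finally show ?thesis
    by (simp add: \<Delta>_def R_def)
qed

end
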